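(* For every cycle $C_n$ on $n\ge3$ vertices (embedded in the plane), $\pi_{fl}(C_n)\le 5$.
   Context: A sequence $r_1\dots r_{2n}$ is a repetition if $r_i=r_{n+i}$ for all $i\le n$. In a plane graph $G$, a facial path is a path whose vertices and edges are consecutive on the boundary walk of some face of $G$. A vertex colouring is facial non-repetitive if no facial path on vertices $v_1,\dots,v_{2n}$ ($n\ge1$) has colour sequence that is a repetition. $\pi_{fl}(G)$ is the minimum $l$ such that for every assignment of lists $L(v)\subseteq\mathbb{Z}_+$ with $|L(v)|\ge l$ there is a facial non-repetitive colouring $\varphi$ with $\varphi(v)\in L(v)$ for every vertex $v$. *)

theory Defs
  imports "HOL-Analysis.Analysis" "HOL-Library.Extended_Nat"
begin

text \<open>
  The plane is the type \<^typ>\<open>complex\<close>. An edge is a closed arc, i.e. a point set that includes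
  its two endpoints; as \<^const>\<open>arc\<close> requires injectivity on the closed unit interval, there are no loops.
\<close>

definition joins :: "complex set \<Rightarrow> complex \<Rightarrow> complex \<Rightarrow> bool" where
  "joins e u v \<longleftrightarrow> (\<exists>g. arc g \<and> path_image g = e \<and> pathstart g = u \<and> pathfinish g = v)"

text \<open>
  Finite simple plane graphs: the interior of an edge contains neither a vertex nor a point of
  another edge, and different edges have different endpoint sets. Finiteness of \<open>E\<close> follows.
\<close>

definition plane_graph :: "complex set \<Rightarrow> complex set set \<Rightarrow> bool" where
  "plane_graph V E \<longleftrightarrow>
     finite V \<and>
     (\<forall>e\<in>E. \<exists>u\<in>V. \<exists>v\<in>V. joins e u v \<and> e \<inter> V = {u, v}) \<and>
     (\<forall>e\<in>E. \<forall>e'\<in>E. e \<noteq> e' \<longrightarrow> e \<inter> e' \<subseteq> V \<and> e \<inter> V \<noteq> e' \<inter> V)"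

definition faces :: "complex set \<Rightarrow> complex set set \<Rightarrow> complex set set" where
  "faces V E = components (- (V \<union> \<Union>E))"

text \<open>
  A boundary walk of a face \<open>F\<close> is the closed walk
  \<open>ws ! 0, es ! 0, ws ! 1, es ! 1, \<dots>, es ! (k - 1), ws ! 0\<close> described by going once around a
  boundary component of \<open>F\<close> while staying infinitesimally inside \<open>F\<close>. This is made precise
  by a collar: the half-open annulus \<open>1 \<le> |z| < 2\<close> is mapped continuously so that its
  interior is embedded in \<open>F\<close>, while its boundary circle, cut into \<open>k\<close> equal circular arcs,
  runs through the edges \<open>es ! i\<close> in turn. The map need not be injective on the
  circle: cut vertices are visited several times, and a bridge is traversed once in each direction.
  The injectivity on the interior excludes spurious backtracking and going around repeatedly. Both
  directions of traversal are admitted (compose the map with complex conjugation), as is every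
  starting vertex.
  A face whose boundary is disconnected has several boundary walks.
\<close>

definition boundary_walk ::
    "complex set \<Rightarrow> complex set set \<Rightarrow> complex set \<Rightarrow> complex list \<Rightarrow> complex set list \<Rightarrow> bool" where
  "boundary_walk V E F ws es \<longleftrightarrow>
     ws \<noteq> [] \<and> length es = length ws \<and> set ws \<subseteq> V \<and> set es \<subseteq> E \<and>
     (\<exists>H :: complex \<Rightarrow> complex.
        continuous_on {z. 1 \<le> cmod z \<and> cmod z < 2} H \<and>
        inj_on H {z. 1 < cmod z \<and> cmod z < 2} \<and>
        H ` {z. 1 < cmod z \<and> cmod z < 2} \<subseteq> F \<and>
        (\<forall>i<length ws.
           let g = (\<lambda>t. H (cis (2 * pi * (real i + t) / real (length ws)))) in
             arc g \<and> path_image g = es ! i \<and>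
             pathstart g = ws ! i \<and> pathfinish g = ws ! (Suc i mod length ws)))"

definition graph_path ::
    "complex set \<Rightarrow> complex set set \<Rightarrow> complex list \<Rightarrow> complex set list \<Rightarrow> bool" where
  "graph_path V E ps qs \<longleftrightarrow>
     length ps = Suc (length qs) \<and> distinct ps \<and> set ps \<subseteq> V \<and> set qs \<subseteq> E \<and>
     (\<forall>i<length qs. joins (qs ! i) (ps ! i) (ps ! Suc i))"

text \<open>
  Positions on a boundary walk are cyclic; \<open>j\<close> is the starting position of the path.
\<close>

definition facial_path ::
    "complex set \<Rightarrow> complex set set \<Rightarrow> complex list \<Rightarrow> complex set list \<Rightarrow> bool" where
  "facial_path V E ps qs \<longleftrightarrow>
     graph_path V E ps qs \<and>
     (\<exists>F\<in>faces V E. \<exists>ws es j. boundary_walk V E F ws es \<and>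
        (\<forall>i<length ps. ps ! i = ws ! ((j + i) mod length ws)) \<and>
        (\<forall>i<length qs. qs ! i = es ! ((j + i) mod length es)))"

definition repetition :: "'a list \<Rightarrow> bool" where
  "repetition rs \<longleftrightarrow>
     (\<exists>n\<ge>1. length rs = 2 * n \<and> (\<forall>i<n. rs ! i = rs ! (n + i)))"

definition facial_nonrepetitive ::
    "complex set \<Rightarrow> complex set set \<Rightarrow> (complex \<Rightarrow> nat) \<Rightarrow> bool" where
  "facial_nonrepetitive V E \<phi> \<longleftrightarrow>
     (\<forall>ps qs. facial_path V E ps qs \<longrightarrow> \<not> repetition (map \<phi> ps))"

text \<open>
  Infinite lists are admitted explicitly because \<^const>\<open>card\<close> is 0 on infinite sets.
\<close>

definition facial_nonrepetitive_choosable ::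
    "complex set \<Rightarrow> complex set set \<Rightarrow> nat \<Rightarrow> bool" where
  "facial_nonrepetitive_choosable V E l \<longleftrightarrow>
     (\<forall>L :: complex \<Rightarrow> nat set.
        (\<forall>v\<in>V. L v \<subseteq> {1..} \<and> (infinite (L v) \<or> l \<le> card (L v))) \<longrightarrow>
        (\<exists>\<phi>. facial_nonrepetitive V E \<phi> \<and> (\<forall>v\<in>V. \<phi> v \<in> L v)))"

text \<open>
  The infimum in \<^typ>\<open>enat\<close> is a minimum if some \<open>l\<close> qualifies and \<open>\<infinity>\<close> otherwise, so an
  upper bound on it always carries content.
\<close>

definition pi_fl :: "complex set \<Rightarrow> complex set set \<Rightarrow> enat" where
  "pi_fl V E = Inf {enat l | l. facial_nonrepetitive_choosable V E l}"

text \<open>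
  The abstract graph underlying \<open>(V, E)\<close> is isomorphic to the cycle on \<open>{0, \<dots>, n - 1}\<close>
  (meaningful for \<open>n \<ge> 3\<close>).
\<close>

definition is_cycle_graph :: "complex set \<Rightarrow> complex set set \<Rightarrow> nat \<Rightarrow> bool" where
  "is_cycle_graph V E n \<longleftrightarrow>
     (\<exists>v :: nat \<Rightarrow> complex. bij_betw v {..<n} V \<and>
        (\<forall>i<n. \<forall>j<n. (\<exists>e\<in>E. joins e (v i) (v j)) \<longleftrightarrow> j = Suc i mod n \<or> i = Suc j mod n))"

end

theory Submission imports Defs begin

text \<open>
  The argument is Rosenfeld's counting method. Every facial path of a cycle is an arc of it, so it
  suffices to avoid repetitions on all arcs. Cut the lists down to five colours. If adding a vertex
  to an arc creates a repetition, the half containing the new vertex is determined by the other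
  half. So the number of failed extensions is at most the number of good colourings of what
  remains after deleting that half. Hence, by induction, each added vertex multiplies the number of
  good colourings of an arc by at least \<open>3\<close>, since \<open>3 + (1 + 1/3 + 1/9 + \<dots>) \<le> 5\<close>.
  Let \<open>N\<close> be the number of good colourings of the cycle minus one vertex. Up to \<open>2k\<close>
  arcs of \<open>2k\<close> vertices contain the last vertex, and each spoils at most \<open>N / 3 ^ (k - 1)\<close>
  of the \<open>5N\<close> extensions. Since \<open>(\<Sum>k\<ge>1. 2k / 3 ^ (k - 1)) = 9/2 < 5\<close>, some
  extension survives.
\<close>

section \<open>Counting failed extensions by one vertex\<close>

text \<open>Each \<open>t\<close> is a way to fail: the colours on \<open>D t\<close> are copied
  through \<open>h t\<close> from outside \<open>D t\<close>. A failed colouring of type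
  \<open>t\<close> is thus determined by its restriction outside \<open>D t\<close>, which lies in
  \<open>W t\<close>. The union bound over \<open>T\<close> compares this with the
  \<open>card (L x) * card P\<close> extensions.\<close>

lemma card_extensions_le:
  fixes L :: "'i \<Rightarrow> 'c set" and D :: "'t \<Rightarrow> 'i set" and h :: "'t \<Rightarrow> 'i \<Rightarrow> 'i"
  assumes "finite S" "x \<notin> S" "\<And>y. y \<in> insert x S \<Longrightarrow> finite (L y)"
    and "P \<subseteq> PiE S L" "Q \<subseteq> PiE (insert x S) L" "finite T"
    and W: "\<And>t. t \<in> T \<Longrightarrow> finite (W t)"
    and bad: "\<And>f. f \<in> PiE (insert x S) L \<Longrightarrow> restrict f S \<in> P \<Longrightarrow> f \<notin> Q \<Longrightarrow>
      \<exists>t\<in>T. (\<forall>y\<in>D t. h t y \<in> insert x S - D t \<and> f y = f (h t y)) \<and>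
        restrict f (insert x S - D t) \<in> W t"
  shows "card (L x) * card P \<le> card Q + (\<Sum>t\<in>T. card (W t))"
proof -
  define U where "U = insert x S"
  define X where "X = (\<lambda>(y, g). g(x := y)) ` (L x \<times> P)"
  define B where "B = (\<lambda>t. {f \<in> PiE U L. (\<forall>y\<in>D t. h t y \<in> U - D t \<and> f y = f (h t y)) \<and>
        restrict f (U - D t) \<in> W t})"
  have finU: "finite (PiE U L)"
    using assms by (auto simp: U_def intro!: finite_PiE)
  \<comment> \<open>Colourings in \<open>P\<close> are extensional on \<open>S\<close> and
    \<open>x\<close> is not in \<open>S\<close>, so distinct pairs give distinct extensions.\<close>
  have "inj_on (\<lambda>(y, g). g(x := y)) (L x \<times> P)"
    using inj_combinator[OF assms(2), of L] by (rule inj_on_subset) (use assms(4) in auto)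
  then have "card X = card (L x) * card P"
    by (simp add: X_def card_image card_cartesian_product)
  moreover have "X \<subseteq> Q \<union> (\<Union>t\<in>T. B t)"
  proof
    fix f assume "f \<in> X"
    then obtain y g where f: "f = g(x := y)" "y \<in> L x" "g \<in> P" by (auto simp: X_def)
    then have g: "g \<in> PiE S L" using assms(4) by auto
    have "f \<in> PiE U L" using f g by (auto simp: U_def PiE_insert_eq)
    moreover have "restrict f S = g"
      using g f assms(2) by (auto simp: fun_eq_iff restrict_def PiE_def extensional_def)
    ultimately show "f \<in> Q \<union> (\<Union>t\<in>T. B t)"
      using bad[of f] f(3) unfolding B_def U_def by blast
  qed
  moreover have "finite (Q \<union> (\<Union>t\<in>T. B t))"
    using finU assms(5) by (auto simp: B_def U_def intro: finite_subset)
  moreover have "card (B t) \<le> card (W t)" if "t \<in> T" for t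
  proof (rule card_inj_on_le)
    show "inj_on (\<lambda>f. restrict f (U - D t)) (B t)"
    proof (rule inj_onI)
      fix f g assume f: "f \<in> B t" and g: "g \<in> B t"
        and eq: "restrict f (U - D t) = restrict g (U - D t)"
      have out: "f y = g y" if "y \<in> U - D t" for y
        using fun_cong[OF eq, of y] that by (simp add: restrict_def)
      show "f = g"
      proof (rule PiE_ext)
        show "f \<in> PiE U L" "g \<in> PiE U L" using f g by (auto simp: B_def)
        fix y assume "y \<in> U"
        then show "f y = g y"
          using out f g by (cases "y \<in> D t") (auto simp: B_def)
      qed
    qed
  qed (use W that in \<open>auto simp: B_def\<close>)
  then have "card (\<Union>t\<in>T. B t) \<le> (\<Sum>t\<in>T. card (W t))"
    using card_UN_le[OF assms(6), of B] sum_mono[of T "\<lambda>t. card (B t)"] by (meson order_trans)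
  ultimately show ?thesis
    by (metis (no_types, lifting) card_mono card_Un_le add_left_mono order_trans)
qed

section \<open>Non-repetitive colourings of integer intervals\<close>

text \<open>Integer positions let an arc grow on either side. Extensionality makes
  \<open>card\<close> count colourings of the interval itself.\<close>

definition nonrep_colourings :: "(int \<Rightarrow> 'c set) \<Rightarrow> int \<Rightarrow> int \<Rightarrow> (int \<Rightarrow> 'c) set" where
  "nonrep_colourings L a b = {f \<in> PiE {a..<b} L.
     \<forall>i k. a \<le> i \<and> 1 \<le> k \<and> i + 2 * k \<le> b \<longrightarrow> (\<exists>j\<in>{i..<i + k}. f j \<noteq> f (j + k))}"

lemma finite_nonrep_colourings:
  assumes "\<And>i. card (L i) = 5"
  shows "finite (nonrep_colourings L a b)"
proof -
  have "finite (L i)" for i using assms[of i] by (intro card_ge_0_finite) simp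
  then have "finite (PiE {a..<b} L)" by (intro finite_PiE) auto
  then show ?thesis unfolding nonrep_colourings_def by simp
qed

lemma restrict_nonrep_colourings:
  assumes "f \<in> nonrep_colourings L a b" "a \<le> a'" "b' \<le> b"
  shows "restrict f {a'..<b'} \<in> nonrep_colourings L a' b'"
proof -
  have *: "\<exists>j\<in>{i..<i + k}. restrict f {a'..<b'} j \<noteq> restrict f {a'..<b'} (j + k)"
    if "a' \<le> i" "1 \<le> k" "i + 2 * k \<le> b'" for i k
  proof -
    have "a \<le> i \<and> 1 \<le> k \<and> i + 2 * k \<le> b" using that assms by simp
    then obtain j where "j\<in>{i..<i + k}" "f j \<noteq> f (j + k)"
      using assms(1) unfolding nonrep_colourings_def by blast
    then show ?thesis using that by (intro bexI[of _ j]) auto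
  qed
  have "restrict f {a'..<b'} \<in> PiE {a'..<b'} L"
    using assms by (auto simp: nonrep_colourings_def PiE_def Pi_def)
  with * show ?thesis unfolding nonrep_colourings_def by blast
qed

lemma restrict_restrict_nonrep_colourings:
  assumes "restrict f {a..<b} \<in> nonrep_colourings L a b" "a \<le> a'" "b' \<le> b"
  shows "restrict f {a'..<b'} \<in> nonrep_colourings L a' b'"
proof -
  have "{a..<b} \<inter> {a'..<b'} = {a'..<b'}" using assms by auto
  then show ?thesis using restrict_nonrep_colourings[OF assms] by (simp add: restrict_restrict)
qed

text \<open>The induction carries \<open>2 * (sum of N i for i \<le> m) \<le> 3 * N m\<close>, the
  integer form of \<open>1 + 1/3 + 1/9 + ... = 3/2\<close>. With the assumption it yields
  \<open>N (Suc m) \<ge> 7/2 * N m\<close>, more than the factor 3 that closes the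
  induction.\<close>

lemma growth_3:
  fixes N :: "nat \<Rightarrow> nat"
  assumes "\<And>m. 5 * N m \<le> N (Suc m) + (\<Sum>i\<le>m. N i)"
  shows "3 * N m \<le> N (Suc m)"
proof -
  have "2 * (\<Sum>i\<le>m. N i) \<le> 3 * N m" for m
  proof (induction m)
    case (Suc m)
    then show ?case using assms[of m] by simp
  qed simp
  from this[of m] assms[of m] show ?thesis by linarith
qed

lemma nonrep_colourings_extend_right:
  fixes L :: "int \<Rightarrow> 'c set"
  assumes L: "\<And>i. card (L i) = 5"
  shows "3 * card (nonrep_colourings L a (a + int m)) \<le> card (nonrep_colourings L a (a + int (Suc m)))"
proof (rule growth_3[of "\<lambda>m. card (nonrep_colourings L a (a + int m))"])
  fix m
  define b where "b = a + int m"
  have ins: "insert b {a..<b} = {a..<b+1}" by (auto simp: b_def)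
  have finL: "finite (L i)" for i using L[of i] by (intro card_ge_0_finite) simp
  \<comment> \<open>The index \<open>i\<close> counts the vertices left when the second half
    \<open>{a + int i..b}\<close> of a repetition is deleted; \<open>h\<close> moves a vertex back
    by the length of that half.\<close>
  have "card (L b) * card (nonrep_colourings L a b) \<le> card (nonrep_colourings L a (b+1)) +
     (\<Sum>i\<le>m. card (nonrep_colourings L a (a + int i)))"
  proof (rule card_extensions_le[where S = "{a..<b}" and L = L and D = "\<lambda>i. {a + int i..b}" and
       h = "\<lambda>i y. y - (b + 1 - (a + int i))"], unfold ins)
    fix f assume f: "f \<in> PiE {a..<b+1} L" "restrict f {a..<b} \<in> nonrep_colourings L a b"
      "f \<notin> nonrep_colourings L a (b+1)"
    then obtain i k where ik: "a \<le> i" "1 \<le> k" "i + 2 * k \<le> b + 1" "\<And>j. j\<in>{i..<i + k} \<Longrightarrow> f j = f (j + k)"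
      unfolding nonrep_colourings_def by blast
    \<comment> \<open>A repetition that stops before \<open>b\<close> would already lie in the good
      colouring of \<open>{a..<b}\<close>.\<close>
    have ends: "i + 2 * k = b + 1"
    proof (rule ccontr)
      assume "i + 2 * k \<noteq> b + 1"
      then have "a \<le> i \<and> 1 \<le> k \<and> i + 2 * k \<le> b" using ik by auto
      then obtain j where "j\<in>{i..<i + k}" "restrict f {a..<b} j \<noteq> restrict f {a..<b} (j + k)"
        using f(2) unfolding nonrep_colourings_def by blast
      then show False using ik(4)[of j] \<open>a \<le> i \<and> 1 \<le> k \<and> i + 2 * k \<le> b\<close> by auto
    qed
    define t where "t = nat (i + k - a)"
    have t: "a + int t = i + k" "t \<le> m" using ik ends by (auto simp: t_def b_def)
    have shift: "b + 1 - (a + int t) = k" using t ends by simp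
    have "{a..<b+1} - {a + int t..b} = {a..<a + int t}" using t ik ends by auto
    moreover have "restrict f {a..<a + int t} \<in> nonrep_colourings L a (a + int t)"
      using f(2) by (rule restrict_restrict_nonrep_colourings) (use t in \<open>auto simp: b_def\<close>)
    moreover have "y - (b + 1 - (a + int t)) \<in> {a..<a + int t} \<and> f y = f (y - (b + 1 - (a + int t)))"
      if "y \<in> {a + int t..b}" for y
      unfolding shift using that t ends ik(1-3) ik(4)[of "y - k"] by auto
    ultimately show "\<exists>t\<in>{..m}.
      (\<forall>y\<in>{a + int t..b}. y - (b + 1 - (a + int t)) \<in> {a..<b+1} - {a + int t..b} \<and>
         f y = f (y - (b + 1 - (a + int t)))) \<and>
      restrict f ({a..<b+1} - {a + int t..b}) \<in> nonrep_colourings L a (a + int t)"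
      using t by (intro bexI[of _ t]) auto
  qed (use finL finite_nonrep_colourings[of L, OF L] in \<open>auto simp: nonrep_colourings_def\<close>)
  then show "5 * card (nonrep_colourings L a (a + int m)) \<le> card (nonrep_colourings L a (a + int (Suc m))) +
     (\<Sum>i\<le>m. card (nonrep_colourings L a (a + int i)))"
    by (simp add: L b_def algebra_simps)
qed

text \<open>Mirror image of \<open>nonrep_colourings_extend_right\<close>: a new repetition starts
  at the new left end, so its first half is deleted and recovered by shifting forward.\<close>

lemma nonrep_colourings_extend_left:
  fixes L :: "int \<Rightarrow> 'c set"
  assumes L: "\<And>i. card (L i) = 5"
  shows "3 * card (nonrep_colourings L (b - int m) b) \<le> card (nonrep_colourings L (b - int (Suc m)) b)"
proof (rule growth_3[of "\<lambda>m. card (nonrep_colourings L (b - int m) b)"])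
  fix m
  define a where "a = b - int m - 1"
  have ins: "insert a {a+1..<b} = {a..<b}" by (auto simp: a_def)
  have finL: "finite (L i)" for i using L[of i] by (intro card_ge_0_finite) simp
  have "card (L a) * card (nonrep_colourings L (a+1) b) \<le> card (nonrep_colourings L a b) +
     (\<Sum>i\<le>m. card (nonrep_colourings L (b - int i) b))"
  proof (rule card_extensions_le[where S = "{a+1..<b}" and L = L and D = "\<lambda>i. {a..<b - int i}" and
       h = "\<lambda>i y. y + (b - int i - a)"], unfold ins)
    fix f assume f: "f \<in> PiE {a..<b} L" "restrict f {a+1..<b} \<in> nonrep_colourings L (a+1) b"
      "f \<notin> nonrep_colourings L a b"
    then obtain i k where ik: "a \<le> i" "1 \<le> k" "i + 2 * k \<le> b" "\<And>j. j\<in>{i..<i + k} \<Longrightarrow> f j = f (j + k)"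
      unfolding nonrep_colourings_def by blast
    have ends: "i = a"
    proof (rule ccontr)
      assume "i \<noteq> a"
      then have "a + 1 \<le> i \<and> 1 \<le> k \<and> i + 2 * k \<le> b" using ik by auto
      then obtain j where "j\<in>{i..<i + k}" "restrict f {a+1..<b} j \<noteq> restrict f {a+1..<b} (j + k)"
        using f(2) unfolding nonrep_colourings_def by blast
      then show False using ik(4)[of j] \<open>a + 1 \<le> i \<and> 1 \<le> k \<and> i + 2 * k \<le> b\<close> by auto
    qed
    define t where "t = nat (b - (a + k))"
    have t: "b - int t = a + k" "t \<le> m" using ik ends by (auto simp: t_def a_def)
    have shift: "b - int t - a = k" using t ends by simp
    have "{a..<b} - {a..<b - int t} = {b - int t..<b}" using t ik ends by auto
    moreover have "restrict f {b - int t..<b} \<in> nonrep_colourings L (b - int t) b"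
      using f(2) by (rule restrict_restrict_nonrep_colourings) (use t ik in auto)
    moreover have "y + (b - int t - a) \<in> {b - int t..<b} \<and> f y = f (y + (b - int t - a))"
      if "y \<in> {a..<b - int t}" for y
      unfolding shift using that t ends ik(1-3) ik(4)[of y] by auto
    ultimately show "\<exists>t\<in>{..m}.
      (\<forall>y\<in>{a..<b - int t}. y + (b - int t - a) \<in> {a..<b} - {a..<b - int t} \<and>
         f y = f (y + (b - int t - a))) \<and>
      restrict f ({a..<b} - {a..<b - int t}) \<in> nonrep_colourings L (b - int t) b"
      using t by (intro bexI[of _ t]) auto
  qed (use finL finite_nonrep_colourings[of L, OF L] in \<open>auto simp: nonrep_colourings_def\<close>)
  then show "5 * card (nonrep_colourings L (b - int m) b) \<le> card (nonrep_colourings L (b - int (Suc m)) b) +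
     (\<Sum>i\<le>m. card (nonrep_colourings L (b - int i) b))"
    by (simp add: L a_def algebra_simps)
qed

text \<open>Needed on both sides at once: deleting half of a repetition around the last vertex of
  the cycle removes vertices from both ends of the remaining arc.\<close>

lemma nonrep_colourings_extend:
  fixes L :: "int \<Rightarrow> 'c set"
  assumes L: "\<And>i. card (L i) = 5" and "a \<le> b"
  shows "3 ^ (p + q) * card (nonrep_colourings L a b) \<le>
    card (nonrep_colourings L (a - int p) (b + int q))"
proof -
  have right: "3 ^ q * card (nonrep_colourings L a b) \<le> card (nonrep_colourings L a (b + int q))"
  proof (induction q)
    case (Suc q)
    have "3 * card (nonrep_colourings L a (b + int q)) \<le> card (nonrep_colourings L a (b + int (Suc q)))"
      using nonrep_colourings_extend_right[of L a "nat (b - a) + q", OF L] assms(2)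
      by (simp add: algebra_simps)
    with Suc show ?case by simp
  qed simp
  have "3 ^ p * card (nonrep_colourings L a c) \<le> card (nonrep_colourings L (a - int p) c)"
    if "a \<le> c" for c
  proof (induction p)
    case (Suc p)
    have "3 * card (nonrep_colourings L (a - int p) c) \<le> card (nonrep_colourings L (a - int (Suc p)) c)"
      using nonrep_colourings_extend_left[of L c "nat (c - a) + p", OF L] that
      by (simp add: algebra_simps)
    with Suc show ?case by simp
  qed simp
  from this[of "b + int q"] assms(2)
  have "3 ^ p * card (nonrep_colourings L a (b + int q)) \<le> card (nonrep_colourings L (a - int p) (b + int q))"
    by simp
  moreover have "3 ^ p * (3 ^ q * card (nonrep_colourings L a b)) \<le> 3 ^ p * card (nonrep_colourings L a (b + int q))"
    using right by simp
  ultimately show ?thesis by (simp only: power_add mult.assoc)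
qed

lemma nonrep_colourings_nonempty:
  fixes L :: "int \<Rightarrow> 'c set"
  assumes L: "\<And>i. card (L i) = 5" and "a \<le> b"
  shows "0 < card (nonrep_colourings L a b)"
proof -
  \<comment> \<open>The empty interval has exactly one extensional colouring, which starts the
    growth.\<close>
  have "nonrep_colourings L a a = {\<lambda>_. undefined}" by (auto simp: nonrep_colourings_def)
  then have "3 ^ nat (b - a) \<le> card (nonrep_colourings L a b)"
    using nonrep_colourings_extend[of L a a 0 "nat (b - a)", OF L] assms(2) by simp
  moreover have "(0 :: nat) < 3 ^ nat (b - a)" by simp
  ultimately show ?thesis by linarith
qed

section \<open>Closing the arc to a cycle\<close>

text \<open>The exact remainder makes the induction work; dropping it gives the bound
  \<open>9/2\<close>. A half-length \<open>k\<close> has at most \<open>2 * k\<close> arcs through a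
  given vertex, each of weight \<open>1 / 3 ^ (k - 1)\<close>.\<close>

lemma sum_repetition_weights:
  "(\<Sum>k=1..K. 2 * real k / 3 ^ (k - 1)) = 9 / 2 - (3 * real K + 9 / 2) / 3 ^ K"
proof (induction K)
  case (Suc K)
  have "(\<Sum>k=1..Suc K. 2 * real k / 3 ^ (k - 1)) =
      9 / 2 - (3 * real K + 9 / 2) / 3 ^ K + 2 * real (Suc K) / 3 ^ K"
    using Suc by simp
  also have "\<dots> = 9 / 2 - (3 * real (Suc K) + 9 / 2) / 3 ^ Suc K" by (simp add: field_simps)
  finally show ?case .
qed simp

lemma cyclic_nonrep_colouring_exists:
  fixes L :: "int \<Rightarrow> 'c set" and n :: nat
  assumes L: "\<And>i. card (L i) = 5" and n: "n \<ge> 1"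
  shows "\<exists>f. (\<forall>i\<in>{0..<int n}. f i \<in> L i) \<and>
    (\<forall>i k. 1 \<le> k \<and> 2 * k \<le> int n \<longrightarrow> (\<exists>j\<in>{i..<i + k}. f (j mod int n) \<noteq> f ((j + k) mod int n)))"
proof -
  \<comment> \<open>Starts range over \<open>{1..int n}\<close>, not \<open>{0..<int n}\<close>, so
    that a block avoiding vertex \<open>0\<close> is an ordinary interval inside
    \<open>{1..<int n}\<close>.\<close>
  define Q where "Q = {f \<in> PiE {0..<int n} L. \<forall>i\<in>{1..int n}. \<forall>k. 1 \<le> k \<and> 2 * k \<le> int n \<longrightarrow>
    (\<exists>j\<in>{i..<i + k}. f (j mod int n) \<noteq> f ((j + k) mod int n))}"
  \<comment> \<open>The last vertex is \<open>0\<close>. A triple \<open>(k, c, s)\<close> encodes a repetition whose half containing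
    \<open>0\<close> is \<open>{-c..<k - c}\<close> modulo \<open>n\<close>; the other half follows it if \<open>s = 1\<close> and precedes it
    if \<open>s = -1\<close>.\<close>
  define T where "T = (SIGMA k:{1..n}. {..<k} \<times> {1, -1 :: int})"
  define W where "W = (\<lambda>(k, c, s :: int). nonrep_colourings L (int k - int c) (int n - int c))"
  define D where "D = (\<lambda>(k, c, s :: int). {0..<int k - int c} \<union> {int n - int c..<int n})"
  define h where "h = (\<lambda>(k, c :: nat, s) y. (y + s * int k) mod int n)"
  define N where "N = card (nonrep_colourings L 1 (int n))"
  have ins: "insert 0 {1..<int n} = {0..<int n}" using n by auto
  have finL: "finite (L i)" for i using L[of i] by (intro card_ge_0_finite) simp
  have "card (L 0) * N \<le> card Q + (\<Sum>t\<in>T. card (W t))"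
    unfolding N_def
  proof (rule card_extensions_le[where S = "{1..<int n}" and L = L and D = D and h = h], unfold ins)
    fix f assume f: "f \<in> PiE {0..<int n} L" "restrict f {1..<int n} \<in> nonrep_colourings L 1 (int n)"
      "f \<notin> Q"
    then obtain i k where ik: "1 \<le> i" "i \<le> int n" "1 \<le> k" "2 * k \<le> int n"
      "\<And>j. j \<in> {i..<i + k} \<Longrightarrow> f (j mod int n) = f ((j + k) mod int n)"
      unfolding Q_def by auto
    \<comment> \<open>The block must reach position \<open>n\<close>, that is vertex
      \<open>0\<close>; otherwise it contradicts the good colouring of
      \<open>{1..<int n}\<close>.\<close>
    have thr: "int n < i + 2 * k"
    proof (rule ccontr)
      assume "\<not> int n < i + 2 * k"
      then have *: "1 \<le> i \<and> 1 \<le> k \<and> i + 2 * k \<le> int n" using ik by auto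
      then obtain j where "j\<in>{i..<i + k}" "restrict f {1..<int n} j \<noteq> restrict f {1..<int n} (j + k)"
        using f(2) unfolding nonrep_colourings_def by blast
      then show False using ik(5)[of j] * by auto
    qed
    define s :: int where "s = (if int n < i + k then 1 else -1)"
    define c where "c = nat (if int n < i + k then int n - i else int n - i - k)"
    define t where "t = (nat k, c, s)"
    have c: "int c = (if int n < i + k then int n - i else int n - i - k)" "int c < k"
      using ik thr by (auto simp: c_def)
    have tT: "t \<in> T" using ik c by (auto simp: t_def T_def s_def)
    have diff: "{0..<int n} - D t = {k - int c..<int n - int c}"
      using c(2) ik(3,4) by (auto simp: D_def t_def)
    have D: "h t y \<in> {0..<int n} - D t \<and> f y = f (h t y)" if "y \<in> D t" for y
    proof -
      \<comment> \<open>Lift \<open>y\<close> to its representative in \<open>{-c..<k - c}\<close>,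
        where the half around \<open>0\<close> becomes an interval.\<close>
      define j where "j = (if y < k - int c then y else y - int n)"
      have j: "- int c \<le> j" "j < k - int c" using that ik(3,4) c(2) by (auto simp: j_def D_def t_def)
      have y: "y = j mod int n"
        using that ik(3,4) c(2) by (auto simp: j_def D_def t_def minus_mod_self2)
      have hy: "h t y = (j + s * k) mod int n"
        using ik(3) by (simp add: h_def t_def y mod_simps)
      show ?thesis
      proof (cases "int n < i + k")
        case True
        have "h t y = j + k" using hy True j ik c by (simp add: s_def)
        moreover have "f y = f ((j + k) mod int n)"
          using ik(5)[of "j + int n"] j True c y mod_add_self2[of "j + k" "int n"]
          by (simp add: algebra_simps)
        ultimately show ?thesis using hy True j ik(3,4) c(2) diff by (auto simp: s_def)
      next
        case False
        have "h t y = (j - k + int n) mod int n" using hy False by (simp add: s_def)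
        also have "\<dots> = j - k + int n" using j ik(3,4) c(2) by (intro mod_pos_pos_trivial) auto
        finally have hy': "h t y = j - k + int n" .
        have "f y = f (h t y)"
          using ik(5)[of "j - k + int n"] j False c y hy hy' by (simp add: s_def)
        then show ?thesis using hy' j ik(3,4) c(2) diff by auto
      qed
    qed
    have "restrict f {k - int c..<int n - int c} \<in> nonrep_colourings L (k - int c) (int n - int c)"
      using f(2) by (rule restrict_restrict_nonrep_colourings) (use c(2) in auto)
    then have "restrict f ({0..<int n} - D t) \<in> W t"
      using ik(3) diff by (simp add: W_def t_def)
    with tT D show "\<exists>t\<in>T. (\<forall>y\<in>D t. h t y \<in> {0..<int n} - D t \<and> f y = f (h t y)) \<and>
        restrict f ({0..<int n} - D t) \<in> W t" by blast
  qed (use finL finite_nonrep_colourings[of L, OF L] in \<open>auto simp: nonrep_colourings_def Q_def T_def W_def\<close>)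
  then have "5 * real N \<le> real (card Q) + (\<Sum>t\<in>T. real (card (W t)))"
    by (simp add: L flip: of_nat_sum of_nat_add of_nat_mult)
  also have "(\<Sum>t\<in>T. real (card (W t))) \<le> (\<Sum>(k, c, s)\<in>T. real N / 3 ^ (k - 1))"
  proof (rule sum_mono, clarify)
    fix k c s assume "(k, c, s) \<in> T"
    then have k: "1 \<le> k" "k \<le> n" "c < k" by (auto simp: T_def)
    \<comment> \<open>The arc left over lacks \<open>k - 1 - c\<close> vertices of
      \<open>{1..<int n}\<close> on the left and \<open>c\<close> on the right, \<open>k - 1\<close>
      in all.\<close>
    have "3 ^ (k - 1 - c + c) * card (W (k, c, s)) \<le> N"
      using nonrep_colourings_extend[of L "int k - int c" "int n - int c" "k - 1 - c" c, OF L] k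
      by (simp add: W_def N_def)
    then have "real (3 ^ (k - 1) * card (W (k, c, s))) \<le> real N"
      using k by (subst of_nat_le_iff) simp
    then show "real (card (W (k, c, s))) \<le> real N / 3 ^ (k - 1)"
      by (simp add: field_simps)
  qed
  \<comment> \<open>The \<open>k\<close> offsets \<open>c\<close> and the two signs \<open>s\<close>
    give the factor \<open>2 * k\<close>.\<close>
  also have "(\<Sum>(k, c, s)\<in>T. real N / 3 ^ (k - 1)) = (\<Sum>k=1..n. 2 * real k * (real N / 3 ^ (k - 1)))"
    unfolding T_def by (subst sum.Sigma[symmetric]) (auto simp: case_prod_unfold card_cartesian_product)
  also have "\<dots> = real N * (\<Sum>k=1..n. 2 * real k / 3 ^ (k - 1))"
    by (simp add: sum_distrib_left mult_ac)
  also have "\<dots> \<le> real N * (9 / 2)"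
    by (intro mult_left_mono) (simp_all only: sum_repetition_weights, simp_all)
  finally have "real N / 2 \<le> real (card Q)" by simp
  moreover have "N > 0" unfolding N_def using n by (intro nonrep_colourings_nonempty L) auto
  ultimately have "card Q > 0" by (cases "card Q") auto
  then have "Q \<noteq> {}" by auto
  then obtain f where f: "f \<in> Q" by auto
  have "\<exists>j\<in>{i..<i + k}. f (j mod int n) \<noteq> f ((j + k) mod int n)"
    if k: "1 \<le> k" "2 * k \<le> int n" for i k
  proof -
    \<comment> \<open>Subtracting this multiple of \<open>n\<close> brings any start
      \<open>i\<close> into \<open>{1..int n}\<close>.\<close>
    define d where "d = (i - 1) div int n * int n"
    have "i - d - 1 = (i - 1) mod int n" unfolding d_def by (simp add: minus_div_mult_eq_mod[symmetric])
    then have "i - d \<in> {1..int n}"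
      using n pos_mod_bound[of "int n" "i - 1"] pos_mod_sign[of "int n" "i - 1"]
      unfolding atLeastAtMost_iff by linarith
    then obtain j where j: "j \<in> {i - d..<i - d + k}" "f (j mod int n) \<noteq> f ((j + k) mod int n)"
      using f k unfolding Q_def by blast
    have "(j + d) mod int n = j mod int n" "(j + d + k) mod int n = (j + k) mod int n"
      using mod_mult_self1[of "j + k" "(i - 1) div int n" "int n"]
      by (simp_all add: d_def algebra_simps)
    with j show ?thesis by (intro bexI[of _ "j + d"]) auto
  qed
  then show ?thesis using f by (intro exI[of _ f]) (auto simp: Q_def)
qed

section \<open>Paths in a cycle\<close>

text \<open>Each step is \<open>1\<close> or \<open>-1\<close> modulo \<open>n\<close>. A change of
  sign would return to the vertex two steps back, against injectivity, so the first step fixes the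
  direction.\<close>

lemma cycle_walk_monotone:
  fixes u :: "nat \<Rightarrow> nat"
  assumes adj: "\<And>i. Suc i < l \<Longrightarrow> u (Suc i) = Suc (u i) mod n \<or> u i = Suc (u (Suc i)) mod n"
    and inj: "inj_on u {..<l}" and bound: "\<And>i. i < l \<Longrightarrow> u i < n"
  shows "\<exists>s\<in>{1, -1 :: int}. \<forall>i<l. int (u i) = (int (u 0) + s * int i) mod int n"
proof -
  have step: "\<exists>s\<in>{1, -1 :: int}. int (u (Suc i)) = (int (u i) + s) mod int n" if "Suc i < l" for i
    using adj[OF that]
  proof
    assume "u (Suc i) = Suc (u i) mod n"
    then show ?thesis by (intro bexI[of _ 1]) (auto simp: of_nat_mod add.commute)
  next
    assume "u i = Suc (u (Suc i)) mod n"
    then have "(int (u i) + -1) mod int n = int (u (Suc i)) mod int n"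
      by (simp add: of_nat_mod mod_simps)
    then show ?thesis using bound[OF that] by (intro bexI[of _ "-1"]) auto
  qed
  have zero: "int (u 0) = int (u 0) mod int n" if "0 < l"
    using bound[OF that] by simp
  have main: "int (u i) = (int (u 0) + s * int i) mod int n"
    if s: "s \<in> {1, -1}" "int (u 1) = (int (u 0) + s) mod int n" and "i < l" for s i
    using \<open>i < l\<close>
  proof (induction i rule: less_induct)
    case (less i)
    consider "i = 0" | "i = 1" | k where "i = Suc (Suc k)"
      by (metis One_nat_def not0_implies_Suc)
    then show ?case
    proof cases
      case 3
      have IH: "int (u k) = (int (u 0) + s * int k) mod int n"
        "int (u (Suc k)) = (int (u 0) + s * int (Suc k)) mod int n"
        using less.IH[of k] less.IH[of "Suc k"] less.prems 3 by auto
      obtain s' where s': "s' \<in> {1, -1}" "int (u i) = (int (u (Suc k)) + s') mod int n"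
        using step[of "Suc k"] less.prems 3 by blast
      have "s' = s"
      proof (rule ccontr)
        assume "s' \<noteq> s"
        then have "s' = - s" using s(1) s'(1) by auto
        then have "u i = u k"
          using s'(2) IH by (simp add: mod_simps algebra_simps flip: of_nat_eq_iff)
        then show False using inj_onD[OF inj, of i k] less.prems 3 by simp
      qed
      then show ?thesis using s'(2) IH(2) 3 by (simp add: mod_simps algebra_simps)
    qed (use zero less.prems s(2) in auto)
  qed
  show ?thesis
  proof (cases "1 < l")
    case True
    then obtain s where "s \<in> {1, -1 :: int}" "int (u 1) = (int (u 0) + s) mod int n"
      using step[of 0] unfolding One_nat_def by blast
    with main show ?thesis by blast
  next
    case False
    then have "\<forall>i<l. i = 0" by auto
    then show ?thesis using zero by auto
  qed
qed

text \<open>By \<open>cycle_walk_monotone\<close> a facial path runs along an arc in one direction,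
  so a repetition on it, read forwards or backwards, is a repetition of \<open>f\<close> on a cyclic
  block.\<close>

lemma facial_nonrepetitive_cycle:
  assumes v: "bij_betw v {..<n} V"
    and adj: "\<And>i j. i < n \<Longrightarrow> j < n \<Longrightarrow> \<exists>e\<in>E. joins e (v i) (v j) \<Longrightarrow> j = Suc i mod n \<or> i = Suc j mod n"
    and \<phi>: "\<And>i. i < n \<Longrightarrow> \<phi> (v i) = f (int i)"
    and f: "\<And>i k. 1 \<le> k \<Longrightarrow> 2 * k \<le> int n \<Longrightarrow> \<exists>j\<in>{i..<i + k}. f (j mod int n) \<noteq> f ((j + k) mod int n)"
  shows "facial_nonrepetitive V E \<phi>"
  unfolding facial_nonrepetitive_def
proof (intro allI impI notI)
  fix ps qs assume "facial_path V E ps qs" and rep: "repetition (map \<phi> ps)"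
  then have ps: "length ps = Suc (length qs)" "distinct ps" "set ps \<subseteq> V" "set qs \<subseteq> E"
      "\<And>i. i < length qs \<Longrightarrow> joins (qs ! i) (ps ! i) (ps ! Suc i)"
    by (auto simp: facial_path_def graph_path_def)
  define l where "l = length ps"
  define u where "u = (\<lambda>i. inv_into {..<n} v (ps ! i))"
  have V: "ps ! i \<in> v ` {..<n}" if "i < l" for i
    using that ps(3) v by (auto simp: l_def bij_betw_def)
  have vu: "v (u i) = ps ! i" "u i < n" if "i < l" for i
    using V[OF that] f_inv_into_f[OF V[OF that]] inv_into_into[OF V[OF that]] by (auto simp: u_def)
  have inj: "inj_on u {..<l}"
    using vu ps(2) by (metis (no_types, lifting) inj_onI l_def lessThan_iff nth_eq_iff_index_eq)
  have "\<exists>s\<in>{1, -1 :: int}. \<forall>i<l. int (u i) = (int (u 0) + s * int i) mod int n"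
  proof (rule cycle_walk_monotone[OF _ inj])
    fix i assume i: "Suc i < l"
    then have "joins (qs ! i) (v (u i)) (v (u (Suc i)))" "qs ! i \<in> E"
      using ps vu by (auto simp: l_def)
    then show "u (Suc i) = Suc (u i) mod n \<or> u i = Suc (u (Suc i)) mod n"
      using adj vu i by (meson Suc_lessD)
  qed (use vu in auto)
  then obtain s where s: "s \<in> {1, -1 :: int}" "\<And>i. i < l \<Longrightarrow> int (u i) = (int (u 0) + s * int i) mod int n"
    by blast
  obtain k where k: "k \<ge> 1" "l = 2 * k" "\<And>i. i < k \<Longrightarrow> \<phi> (ps ! i) = \<phi> (ps ! (k + i))"
    using rep by (auto simp: repetition_def l_def)
  \<comment> \<open>The path has \<open>2 * k\<close> distinct vertices among \<open>n\<close>, so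
    \<open>f\<close> is constrained at half-length \<open>k\<close>.\<close>
  have "card (u ` {..<l}) \<le> card {..<n}"
    using vu by (intro card_mono) auto
  then have "2 * int k \<le> int n" using inj k(2) by (simp add: card_image)
  have col: "\<phi> (ps ! i) = f ((int (u 0) + s * int i) mod int n)" if "i < l" for i
    using \<phi>[OF vu(2)[OF that]] vu(1)[OF that] s(2)[OF that] by simp
  have eq: "f ((int (u 0) + s * int i) mod int n) = f ((int (u 0) + s * int (k + i)) mod int n)"
    if "i < k" for i
    using k(3)[OF that] col[of i] col[of "k + i"] that k(2) by simp
  \<comment> \<open>The lowest position of the path: its start if \<open>s = 1\<close>, its end if
    \<open>s = -1\<close>.\<close>
  define a where "a = (if s = 1 then int (u 0) else int (u 0) - 2 * int k + 1)"
  obtain j where j: "j \<in> {a..<a + int k}" "f (j mod int n) \<noteq> f ((j + int k) mod int n)"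
    using f[of "int k" a] k(1) \<open>2 * int k \<le> int n\<close> by auto
  obtain i where i: "j = a + int i" "i < k"
    using j(1) by (auto intro!: that[of "nat (j - a)"])
  show False
  proof (cases "s = 1")
    case True
    then show False using eq[of i] j(2) i by (simp add: a_def algebra_simps)
  next
    case False
    then have "s = -1" using s(1) by auto
    \<comment> \<open>Read backwards, \<open>a + i\<close> is path index
      \<open>k + (k - 1 - i)\<close> and \<open>a + i + k\<close> is index
      \<open>k - 1 - i\<close>.\<close>
    then show False using eq[of "k - 1 - i"] j(2) i by (auto simp: a_def algebra_simps of_nat_diff)
  qed
qed

section \<open>From vertex lists to lists on the integers\<close>

theorem theorem5:
  fixes V :: "complex set" and E :: "complex set set" and n :: nat
  assumes "n \<ge> 3"
    and "plane_graph V E"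
    and "is_cycle_graph V E n"
  shows "pi_fl V E \<le> 5"
proof -
  obtain v :: "nat \<Rightarrow> complex" where v: "bij_betw v {..<n} V"
    and adj: "\<And>i j. i < n \<Longrightarrow> j < n \<Longrightarrow>
      (\<exists>e\<in>E. joins e (v i) (v j)) \<longleftrightarrow> j = Suc i mod n \<or> i = Suc j mod n"
    using assms(3) unfolding is_cycle_graph_def by blast
  have "facial_nonrepetitive_choosable V E 5"
    unfolding facial_nonrepetitive_choosable_def
  proof (intro allI impI)
    fix L :: "complex \<Rightarrow> nat set"
    assume L: "\<forall>v\<in>V. L v \<subseteq> {1..} \<and> (infinite (L v) \<or> 5 \<le> card (L v))"
    \<comment> \<open>Unrolls the cycle periodically over the integers, so that five-colour sublists
      can be chosen at every position.\<close>
    define w where "w i = v (nat (i mod int n))" for i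
    have "\<exists>A \<subseteq> L (w i). card A = 5" for i
    proof -
      have "nat (i mod int n) < n" using assms(1) by (simp add: nat_less_iff)
      then have "w i \<in> V" using v by (auto simp: w_def bij_betw_def)
      then show ?thesis using L
        by (meson infinite_arbitrarily_large obtain_subset_with_card_n)
    qed
    then obtain L' where L': "\<And>i. L' i \<subseteq> L (w i)" "\<And>i. card (L' i) = 5" by metis
    obtain f where f: "\<And>i. i \<in> {0..<int n} \<Longrightarrow> f i \<in> L' i"
      "\<And>i k. 1 \<le> k \<Longrightarrow> 2 * k \<le> int n \<Longrightarrow> \<exists>j\<in>{i..<i + k}. f (j mod int n) \<noteq> f ((j + k) mod int n)"
      using cyclic_nonrep_colouring_exists[of L' n, OF L'(2)] assms(1) by (metis le_trans one_le_numeral)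
    define \<phi> where "\<phi> x = f (int (inv_into {..<n} v x))" for x
    have \<phi>: "\<phi> (v i) = f (int i)" if "i < n" for i
      using that v by (simp add: \<phi>_def bij_betw_def inv_into_f_f)
    have "\<forall>x\<in>V. \<phi> x \<in> L x"
    proof
      fix x assume "x \<in> V"
      then obtain i where "x = v i" "i < n" using v by (auto simp: bij_betw_def)
      then show "\<phi> x \<in> L x" using \<phi> f(1)[of "int i"] L'(1)[of "int i"] by (auto simp: w_def)
    qed
    moreover have "facial_nonrepetitive V E \<phi>"
      using facial_nonrepetitive_cycle[OF v _ \<phi> f(2)] adj by blast
    ultimately show "\<exists>\<phi>. facial_nonrepetitive V E \<phi> \<and> (\<forall>v\<in>V. \<phi> v \<in> L v)" by blast
  qed
  then have "pi_fl V E \<le> enat 5"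
    unfolding pi_fl_def by (intro Inf_lower) auto
  then show ?thesis by (simp add: numeral_eq_enat)
qed

end
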